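(* Let $p,q\in\mathbb{Z}_+$ with $p\leq q+1$ be fixed. Let $\alpha_1,\dots,\alpha_p,\beta_1,\dots,\beta_q\in(0,+\infty)$ be arbitrary parameters. Then the relation $$e^t\,{}_{p}F_{q}\left(\alpha_1,\dots,\alpha_p;\beta_1,\dots,\beta_q;-xt\right)=\sum_{n=0}^\infty\mathbf{L}_n(x;\alpha_1,\dots,\alpha_p;\beta_1,\dots,\beta_q)\,\frac{t^n}{n!}$$ holds for all $t,x\in\mathbb{C}$ with $|t|<1$ and $|x|<1$, where $\mathbf{L}_n(x;\alpha_1,\dots,\alpha_p;\beta_1,\dots,\beta_q)={}_{p+1}F_q(-n,\alpha_1,\dots,\alpha_p;\beta_1,\dots,\beta_q;x)$. If $p\leq q$, then the relation holds for all $t,x\in\mathbb{C}$.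
   Context: $\mathbb{Z}_+$ is the set of non-negative integers. The Pochhammer symbol is $(c)_0=1$, $(c)_k=c(c+1)\cdots(c+k-1)$ for $k\ge1$. The generalized hypergeometric function is $${}_mF_n(a_1,\dots,a_m;b_1,\dots,b_n;x)=\sum_{k=0}^\infty\frac{(a_1)_k\cdots(a_m)_k}{(b_1)_k\cdots(b_n)_k}\frac{x^k}{k!}.$$ When one of the upper parameters is $-n$ with $n\in\mathbb{Z}_+$ the series terminates and is a polynomial in $x$ (sum over $0\le k\le n$). If $p=0$ and/or $q=0$, the parameters $\alpha_k$ and/or $\beta_k$, respectively, are absent. *)

theory Defs
  imports "HOL-Analysis.Analysis"
begin

text \<open>
  The generalized hypergeometric function as an analytic function of its last argument.  The lists
  \<open>as\<close> and \<open>bs\<close> hold the upper and the lower parameters; absent parameters are the empty list,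
  whose \<^const>\<open>prod_list\<close> is 1.  The library's \<^const>\<open>fps_hypergeo\<close> is the formal power series
  version; \<open>hypergeom_eq_eval_fps\<close> below says that the two agree.
\<close>

definition hypergeom_term :: "complex list \<Rightarrow> complex list \<Rightarrow> complex \<Rightarrow> nat \<Rightarrow> complex" where
  "hypergeom_term as bs x k =
     (\<Prod>a\<leftarrow>as. pochhammer a k) / (\<Prod>b\<leftarrow>bs. pochhammer b k) * (x ^ k / fact k)"

definition hypergeom :: "complex list \<Rightarrow> complex list \<Rightarrow> complex \<Rightarrow> complex" where
  "hypergeom as bs x = (\<Sum>k. hypergeom_term as bs x k)"

definition gen_Laguerre :: "nat \<Rightarrow> complex list \<Rightarrow> complex list \<Rightarrow> complex \<Rightarrow> complex" where
  "gen_Laguerre n as bs x = hypergeom (- of_nat n # as) bs x"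

lemma hypergeom_eq_eval_fps: "hypergeom as bs x = eval_fps (fps_hypergeo as bs 1) x"
proof -
  have *: "foldl (\<lambda>r a. r * pochhammer a k) v cs = v * (\<Prod>a\<leftarrow>cs. pochhammer a k)"
    for v :: complex and k cs
    by (induction cs arbitrary: v) (simp_all add: mult.assoc)
  show ?thesis
    by (simp add: hypergeom_def hypergeom_term_def eval_fps_def *)
qed

lemma gen_Laguerre_eq_sum:
  "gen_Laguerre n as bs x = (\<Sum>k\<le>n. hypergeom_term (- of_nat n # as) bs x k)"
proof -
  have "hypergeom_term (- of_nat n # as) bs x k = 0" if "k \<notin> {..n}" for k
    using that by (simp add: hypergeom_term_def pochhammer_of_nat_eq_0_lemma)
  then show ?thesis
    unfolding gen_Laguerre_def hypergeom_def by (intro suminf_finite) auto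
qed

text \<open>
  Convergence of the defining series, which makes the \<^const>\<open>suminf\<close> in \<^const>\<open>hypergeom\<close>
  meaningful in the ranges where it is used.
\<close>

lemma summable_hypergeom_term:
  assumes "length as \<le> length bs \<or> (length as = length bs + 1 \<and> norm x < 1)"
  shows "summable (hypergeom_term as bs x)"
proof -
  define R where "R cs k = (\<Prod>c\<leftarrow>cs. (c + of_nat k) / of_nat (Suc k))" for cs :: "complex list" and k
  define d where "d = length bs + 1 - length as"
  define r where "r k = R as k / R bs k * x * (1 / of_nat (Suc k)) ^ d" for k
  have one: "(\<lambda>k. (c + of_nat k) / of_nat (Suc k)) \<longlonglongrightarrow> 1" for c :: complex
  proof -
    have "(\<lambda>k. 1 + (c - 1) * (1 / of_nat (Suc k))) \<longlonglongrightarrow> 1 + (c - 1) * 0"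
      using LIMSEQ_Suc[OF lim_1_over_n] by (intro tendsto_intros)
    moreover have "1 + (c - 1) * (1 / of_nat (Suc k)) = (c + of_nat k) / of_nat (Suc k)" for k
      by (simp add: field_simps del: of_nat_Suc) (simp add: algebra_simps)
    ultimately show ?thesis by simp
  qed
  have R: "R cs \<longlonglongrightarrow> 1" for cs
  proof (induction cs)
    case (Cons c cs)
    from tendsto_mult[OF one[of c] Cons] show ?case by (simp add: R_def del: of_nat_Suc)
  qed (simp add: R_def)
  have inv: "(\<lambda>k. 1 / of_nat (Suc k) :: complex) \<longlonglongrightarrow> 0"
    using LIMSEQ_Suc[OF lim_1_over_n] .
  have "r \<longlonglongrightarrow> 1 / 1 * x * 0 ^ d"
    unfolding r_def by (intro tendsto_intros R inv) auto
  moreover have "norm (1 / 1 * x * 0 ^ d) < 1"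
    using assms by (auto simp: d_def power_0_left)
  ultimately obtain c where c: "c < 1" "eventually (\<lambda>k. norm (r k) < c) sequentially"
    by (metis dense order_tendstoD(2) tendsto_norm)
  then obtain N where N: "\<And>k. k \<ge> N \<Longrightarrow> norm (r k) < c"
    by (auto simp: eventually_sequentially)
  have poch: "(\<Prod>a\<leftarrow>cs. pochhammer a (Suc k)) =
      (\<Prod>a\<leftarrow>cs. pochhammer a k) * (R cs k * of_nat (Suc k) ^ length cs)" for cs :: "complex list" and k
    by (induction cs) (simp_all add: R_def pochhammer_Suc del: of_nat_Suc)
  have step: "hypergeom_term as bs x (Suc k) = r k * hypergeom_term as bs x k" for k
  proof -
    have "of_nat (Suc k) ^ length as / (of_nat (Suc k) ^ length bs * of_nat (Suc k)) =
        (1 / of_nat (Suc k) :: complex) ^ d"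
    proof -
      have "length bs + 1 = length as + d" using assms by (auto simp: d_def)
      then have "of_nat (Suc k) ^ length bs * of_nat (Suc k) =
          (of_nat (Suc k) :: complex) ^ length as * of_nat (Suc k) ^ d"
        by (metis power_add power_one_right)
      then show ?thesis by (simp add: power_one_over field_simps del: of_nat_Suc)
    qed
    then show ?thesis
      unfolding hypergeom_term_def r_def poch fact_Suc
      by (simp add: divide_inverse mult_ac del: of_nat_Suc)
  qed
  show ?thesis
  proof (rule summable_ratio_test[OF c(1)])
    show "norm (hypergeom_term as bs x (Suc k)) \<le> c * norm (hypergeom_term as bs x k)" if "k \<ge> N" for k
      unfolding step norm_mult using N[OF that] by (intro mult_right_mono) auto
  qed
qed

end

theory Submission
  imports Defs
begin

text \<open>
  Since \<open>(-n)\<^sub>k = (-1)\<^sup>k n! / (n - k)!\<close>, the right-hand side is the Cauchy product of the absolutely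
  convergent series for \<open>hypergeom as bs (- x t)\<close> and \<open>exp t\<close>.
\<close>

text \<open>Up to sign and the factor \<open>fact k\<close>, the Pochhammer symbol at -n is the
  binomial coefficient n over k.\<close>

lemma pochhammer_minus_of_nat:
  assumes "k \<le> n"
  shows "pochhammer (- of_nat n :: 'a::field_char_0) k = (-1) ^ k * fact n / fact (n - k)"
proof -
  have "of_nat n gchoose k = (fact n / (fact k * fact (n - k)) :: 'a)"
    using assms by (simp add: binomial_fact flip: binomial_gbinomial)
  then have "(-1) ^ k * pochhammer (- of_nat n :: 'a) k = fact n / fact (n - k)"
    by (simp add: gbinomial_pochhammer field_simps)
  \<comment> \<open>A second factor \<open>(-1) ^ k\<close> cancels the first, since their product
    is 1.\<close>
  then have "(-1) ^ k * ((-1) ^ k * pochhammer (- of_nat n :: 'a) k) = (-1) ^ k * (fact n / fact (n - k))"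
    by simp
  then show ?thesis
    by (simp flip: mult.assoc power_mult_distrib)
qed

text \<open>A power series that converges at some point converges absolutely at every point of
  smaller modulus, and the convergence condition leaves room for a point \<open>r\<close> beyond
  \<open>norm z\<close>.\<close>

lemma summable_norm_hypergeom_term:
  assumes "length as \<le> length bs \<or> (length as = length bs + 1 \<and> norm z < 1)"
  shows "summable (\<lambda>k. norm (hypergeom_term as bs z k))"
proof -
  obtain r where r: "norm z < r" "length as \<le> length bs \<or> (length as = length bs + 1 \<and> r < 1)"
    using assms by (metis dense gt_ex)
  \<comment> \<open>Coefficients free of the argument exhibit the series as a power series.\<close>
  define c where "c k = (\<Prod>a\<leftarrow>as. pochhammer a k) / (\<Prod>b\<leftarrow>bs. pochhammer b k) / fact k" for k
  have c: "hypergeom_term as bs w k = c k * w ^ k" for w k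
    by (simp add: hypergeom_term_def c_def)
  have "r > 0"
    using r(1) norm_ge_zero[of z] by linarith
  then have "summable (hypergeom_term as bs (of_real r))"
    using r(2) by (intro summable_hypergeom_term) auto
  then show ?thesis
    unfolding c using r(1) \<open>r > 0\<close> by (intro powser_insidea[where x = "of_real r"]) auto
qed

text \<open>The exponential series converges absolutely everywhere, so the only constraint is on the
  argument \<open>- (x * t)\<close> of the other factor. Both ranges of the theorem are
  instances.\<close>

lemma gen_Laguerre_sums:
  assumes "length as \<le> length bs \<or> (length as = length bs + 1 \<and> norm (x * t) < 1)"
  shows "(\<lambda>n. gen_Laguerre n as bs x * (t ^ n / fact n)) sums (exp t * hypergeom as bs (- (x * t)))"
proof -
  have exp: "summable (\<lambda>k. norm (t ^ k / fact k))" "exp t = (\<Sum>k. t ^ k / fact k)"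
    using summable_norm_exp[of t]
    by (simp_all add: exp_def scaleR_conv_of_real divide_inverse mult.commute)
  \<comment> \<open>The \<open>fact n\<close> from the Pochhammer symbol cancels the one below
    \<open>t ^ n\<close>, its sign turns \<open>x * t\<close> into \<open>- (x * t)\<close>, and
    splitting \<open>t ^ n\<close> leaves an exponential term of index \<open>n - k\<close>.\<close>
  have term_eq: "hypergeom_term (- of_nat n # as) bs x k * (t ^ n / fact n) =
      hypergeom_term as bs (- (x * t)) k * (t ^ (n - k) / fact (n - k))" if "k \<le> n" for n k
  proof -
    have "t ^ n = t ^ k * t ^ (n - k)"
      using that by (simp flip: power_add)
    moreover have "(- (x * t)) ^ k = (-1) ^ k * x ^ k * t ^ k"
      by (simp add: power_minus[of "x * t"] power_mult_distrib)
    ultimately show ?thesis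
      using that by (simp add: hypergeom_term_def pochhammer_minus_of_nat mult_ac)
  qed
  have "gen_Laguerre n as bs x * (t ^ n / fact n) =
      (\<Sum>k\<le>n. hypergeom_term as bs (- (x * t)) k * (t ^ (n - k) / fact (n - k)))" for n
    unfolding gen_Laguerre_eq_sum sum_distrib_right by (intro sum.cong refl term_eq) simp
  moreover have "summable (\<lambda>k. norm (hypergeom_term as bs (- (x * t)) k))"
    using assms by (intro summable_norm_hypergeom_term) simp
  ultimately show ?thesis
    using Cauchy_product_sums[OF _ exp(1), of "hypergeom_term as bs (- (x * t))"]
    by (simp add: exp(2) hypergeom_def mult.commute)
qed

theorem theorem2:
  fixes p q :: nat and \<alpha> \<beta> :: "real list"
  assumes "p \<le> q + 1"
    and "length \<alpha> = p" and "length \<beta> = q"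
    and "\<forall>a\<in>set \<alpha>. 0 < a" and "\<forall>b\<in>set \<beta>. 0 < b"
  shows "(\<forall>t x :: complex. norm t < 1 \<longrightarrow> norm x < 1 \<longrightarrow>
            (\<lambda>n. gen_Laguerre n (map of_real \<alpha>) (map of_real \<beta>) x * (t ^ n / fact n)) sums
              (exp t * hypergeom (map of_real \<alpha>) (map of_real \<beta>) (- (x * t)))) \<and>
         (p \<le> q \<longrightarrow> (\<forall>t x :: complex.
            (\<lambda>n. gen_Laguerre n (map of_real \<alpha>) (map of_real \<beta>) x * (t ^ n / fact n)) sums
              (exp t * hypergeom (map of_real \<alpha>) (map of_real \<beta>) (- (x * t)))))"
proof (intro conjI allI impI)
  fix t x :: complex
  assume "norm t < 1" "norm x < 1"
  \<comment> \<open>The two bounds combine into one on the argument of the series, which settles the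
    borderline case p = q + 1.\<close>
  then have "norm (x * t) < 1"
    by (metis norm_ge_zero norm_mult mult_strict_mono' mult_1)
  then show "(\<lambda>n. gen_Laguerre n (map of_real \<alpha>) (map of_real \<beta>) x * (t ^ n / fact n)) sums
      (exp t * hypergeom (map of_real \<alpha>) (map of_real \<beta>) (- (x * t)))"
    using assms(1-3) by (intro gen_Laguerre_sums) auto
next
  fix t x :: complex
  assume "p \<le> q"
  then show "(\<lambda>n. gen_Laguerre n (map of_real \<alpha>) (map of_real \<beta>) x * (t ^ n / fact n)) sums
      (exp t * hypergeom (map of_real \<alpha>) (map of_real \<beta>) (- (x * t)))"
    using assms(2,3) by (intro gen_Laguerre_sums) auto
qed

end
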